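(* Let $p,q$ be complex numbers. The generating function of the odd-indexed $(p,q)$-Fibonacci numbers is, as a formal power series in $z$, $$\sum_{n=0}^{\infty}F_{p,q,2n+1}z^n=\frac{1-qz}{1-(p^2+2q)z+q^2z^2}.$$
   Context: The $(p,q)$-Fibonacci numbers are defined by $F_{p,q,0}=0$, $F_{p,q,1}=1$, and $F_{p,q,n}=pF_{p,q,n-1}+qF_{p,q,n-2}$ for $n\ge 2$. *)

theory Defs
  imports "HOL-Computational_Algebra.Formal_Power_Series" Complex_Main
begin

fun pq_fib :: "complex \<Rightarrow> complex \<Rightarrow> nat \<Rightarrow> complex" where
  "pq_fib p q 0 = 0"
| "pq_fib p q (Suc 0) = 1"
| "pq_fib p q (Suc (Suc n)) = p * pq_fib p q (Suc n) + q * pq_fib p q n"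

end

theory Submission
  imports Defs
begin

text \<open>Passing to every second index of the Fibonacci recurrence again gives a second-order
  recurrence (\<open>pq_fib_Suc4\<close>). Its coefficients form the denominator, and the first two
  odd-indexed values, \<open>1\<close> and \<open>p\<^sup>2 + q\<close>, fix the numerator
  (\<open>fps_linear_recurrence_order2\<close>).\<close>

text \<open>The squares of the roots of x^2 - p x - q have sum p^2 + 2q and product q^2.\<close>

lemma pq_fib_Suc4:
  "pq_fib p q (Suc (Suc (Suc (Suc n)))) =
    (p\<^sup>2 + 2 * q) * pq_fib p q (Suc (Suc n)) - q\<^sup>2 * pq_fib p q n"
  by (simp add: power2_eq_square algebra_simps)

lemma fps_eq_divide_if_mult_eq:
  fixes f g h :: "'a::field fps"
  assumes "f * g = h" and "fps_nth g 0 \<noteq> 0"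
  shows "f = h / g"
proof -
  have "g \<noteq> 0"
    using assms(2) by auto
  then show ?thesis
    using assms(1) by (metis nonzero_mult_div_cancel_right)
qed

text \<open>After multiplication by the denominator, whose constant term is 1, the recurrence
  cancels every coefficient from degree two on, leaving a linear polynomial in
  \<open>fps_X\<close>.\<close>

lemma fps_linear_recurrence_order2:
  fixes a :: "nat \<Rightarrow> 'a::field"
  assumes rec: "\<And>n. a (Suc (Suc n)) = c * a (Suc n) - d * a n"
  shows "Abs_fps a = (fps_const (a 0) + fps_const (a 1 - c * a 0) * fps_X) /
    (1 - fps_const c * fps_X + fps_const d * fps_X\<^sup>2)"
proof (rule fps_eq_divide_if_mult_eq)
  have "Abs_fps a * (1 - fps_const c * fps_X + fps_const d * fps_X\<^sup>2) =
      Abs_fps a - fps_const c * (fps_X * Abs_fps a) + fps_const d * (fps_X\<^sup>2 * Abs_fps a)"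
    by (simp add: algebra_simps)
  also have "\<dots> = fps_const (a 0) + fps_const (a 1 - c * a 0) * fps_X"
  proof (rule fps_ext)
    fix n :: nat
    \<comment> \<open>The recurrence applies only from degree two on; degrees 0 and 1 produce the
      initial data.\<close>
    consider "n = 0" | "n = 1" | m where "n = Suc (Suc m)"
      by (metis One_nat_def not0_implies_Suc)
    then show "fps_nth (Abs_fps a - fps_const c * (fps_X * Abs_fps a)
          + fps_const d * (fps_X\<^sup>2 * Abs_fps a)) n =
        fps_nth (fps_const (a 0) + fps_const (a 1 - c * a 0) * fps_X) n"
      by cases (simp_all add: fps_X_power_mult_nth rec)
  qed
  finally show "Abs_fps a * (1 - fps_const c * fps_X + fps_const d * fps_X\<^sup>2) =
      fps_const (a 0) + fps_const (a 1 - c * a 0) * fps_X" .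
qed simp

theorem proposition3:
  fixes p q :: complex
  shows "Abs_fps (\<lambda>n. pq_fib p q (2 * n + 1)) =
    (1 - fps_const q * fps_X) /
    (1 - fps_const (p\<^sup>2 + 2 * q) * fps_X + fps_const (q\<^sup>2) * fps_X\<^sup>2)"
proof -
  define a where "a n = pq_fib p q (2 * n + 1)" for n
  have rec: "a (Suc (Suc n)) = (p\<^sup>2 + 2 * q) * a (Suc n) - q\<^sup>2 * a n" for n
    \<comment> \<open>Two steps of \<open>a\<close> are four steps of \<open>pq_fib\<close>; the
      unfolding turns \<open>2 * Suc n + 1\<close> into
      \<open>Suc (Suc (2 * n + 1))\<close>.\<close>
    using pq_fib_Suc4[of p q "2 * n + 1"] unfolding a_def mult_Suc_right add_2_eq_Suc add_Suc .
  have "a 0 = 1" "a 1 = p\<^sup>2 + q"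
    by (simp_all add: a_def numeral_2_eq_2)
  \<comment> \<open>The linear coefficient is (p^2 + q) - (p^2 + 2q) = -q.\<close>
  then have "fps_const (a 0) + fps_const (a 1 - (p\<^sup>2 + 2 * q) * a 0) * fps_X = 1 - fps_const q * fps_X"
    by (simp flip: fps_const_neg)
  moreover have "Abs_fps (\<lambda>n. pq_fib p q (2 * n + 1)) = Abs_fps a"
    unfolding a_def ..
  ultimately show ?thesis
    using fps_linear_recurrence_order2[of a, OF rec] by (simp only:)
qed

end
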